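(* Let $1 \le p < \infty$ and $0 < \varepsilon < 1$. There exists a randomized linear sketch of dimension $O(p \cdot \varepsilon^{-1} \log(\varepsilon^{-1}) \cdot n^{1-1/p} \log n)$ such that for every nonnegative vector $x \in \mathbb{R}_{\ge 0}^n$, the output estimate $\hat{x}$ never overestimates any $x_i$ (i.e., $\hat{x}_i \le x_i$ for all $i$ always), and with probability at least $9/10$, $\hat{x}_i \ge x_i - \varepsilon \|x\|_p$ for all $i \in [n]$.
   Context: A linear sketch of dimension $k$ on $\mathbb{R}^n$ consists of a random matrix $A \in \mathbb{R}^{k\times n}$ (with distribution independent of the input) together with a recovery procedure that outputs an estimate $\hat{x}$ from $A$ and $Ax$ only. $\|x\|_p = (\sum_i |x_i|^p)^{1/p}$; the $O(\cdot)$ hides an absolute constant.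
   Formalization: The factors log(1/ε) and log n in the dimension bound are read as max(1, ln(1/ε)) and max(1, ln n), because the literal bound forces dimension 0 at n = 1 or as ε tends to 1, where no such sketch exists. *)

theory Defs
  imports "HOL-Probability.Probability" "Jordan_Normal_Form.Matrix"
begin

(* Both parent libraries bind this infix; here it is indexing of vectors of dynamic dimension. *)
no_notation Finite_Cartesian_Product.vec_nth (infixl \<open>$\<close> 90)

definition lp_norm :: "real \<Rightarrow> real vec \<Rightarrow> real" where
  "lp_norm p x = (\<Sum>i<dim_vec x. \<bar>x $ i\<bar> powr p) powr (1 / p)"

(* The random matrix is given by its law M, a probability measure on the set space M of its
   possible outcomes.  The sigma-algebra of M is only required to make the entries measurable,
   so every random matrix on an arbitrary probability space is covered.  The recovery procedure R
   sees the matrix and the sketch only; the estimate it returns has to be a random vector. *)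
definition linear_sketch ::
  "nat \<Rightarrow> nat \<Rightarrow> real mat measure \<Rightarrow> (real mat \<Rightarrow> real vec \<Rightarrow> real vec) \<Rightarrow> bool" where
  "linear_sketch k n M R \<longleftrightarrow>
     prob_space M \<and>
     space M \<subseteq> carrier_mat k n \<and>
     (\<forall>i<k. \<forall>j<n. (\<lambda>A. A $$ (i, j)) \<in> borel_measurable M) \<and>
     (\<forall>A\<in>space M. \<forall>y\<in>carrier_vec k. R A y \<in> carrier_vec n) \<and>
     (\<forall>x\<in>carrier_vec n. \<forall>i<n. (\<lambda>A. R A (A *\<^sub>v x) $ i) \<in> borel_measurable M)"

(* Logarithm inside an asymptotic bound, with the usual convention that it is at least 1.
   With the plain logarithm, C * p * (1 / eps) * ln (1 / eps) * n powr (1 - 1 / p) * ln n would be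
   less than 1 for n = 1 and as eps tends to 1, and no sketch of dimension 0 has the desired
   guarantee.  For eps <= 1/2 and n >= 2 the two readings agree up to an absolute constant. *)
definition log_ge1 :: "real \<Rightarrow> real" where
  "log_ge1 t = max 1 (ln t)"

end

(* Recovery returns, for each coordinate i, the least z_i over all nonnegative z that have the
   observed sketch; this never exceeds x_i, whatever the matrix is. To bound it from below, hash the
   coordinates into m = O(n^(1-1/p) / eps) buckets and measure each bucket along the positions of a
   code of length O(log n) over 16 symbols in which two words agree in at most half of the
   positions. A combination of these measurements shows z_i >= x_i - (mass of the other entries
   in the bucket of i). As |x|_1 <= n^(1-1/p) |x|_p, Markov's inequality bounds that mass by
   eps |x|_p with probability at least 3/4. Only the at most eps^(-p) coordinates with
   x_i > eps |x|_p matter, so O(p log(1/eps)) independent hash functions suffice for a union bound. *)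
theory Submission
  imports Defs
begin

section \<open>Comparison of the 1-norm with the p-norm\<close>

text \<open>Jensen's inequality for \<open>powr p\<close> with equal weights \<open>1 / N\<close> on
  the support \<open>P\<close>. Passing from \<open>card P\<close> back to \<open>card I\<close> is
  harmless because the exponent \<open>1 - 1 / p\<close> is nonnegative.\<close>

lemma sum_le_card_powr_mult_lp:
  fixes f :: "'a \<Rightarrow> real"
  assumes I: "finite I" and nn: "\<And>i. i \<in> I \<Longrightarrow> 0 \<le> f i" and p: "1 \<le> p"
  shows "(\<Sum>i\<in>I. f i) \<le> real (card I) powr (1 - 1 / p) * (\<Sum>i\<in>I. f i powr p) powr (1 / p)"
proof (cases "\<exists>i\<in>I. f i \<noteq> 0")
  case False
  then show ?thesis by simp
next
  case True
  define P where "P = {i\<in>I. f i > 0}"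
  have P: "finite P" "P \<noteq> {}" "P \<subseteq> I"
    using True I nn by (auto simp: P_def less_le)
  define N where "N = real (card P)"
  have N: "N > 0" using P by (simp add: N_def card_gt_0_iff)
  have NI: "N \<le> card I" using P I by (simp add: N_def card_mono)
  have s1: "sum f I = sum f P"
    by (rule sum.mono_neutral_right) (use I nn in \<open>force simp: P_def\<close>)+
  have s2: "(\<Sum>i\<in>I. f i powr p) = (\<Sum>i\<in>P. f i powr p)"
    by (rule sum.mono_neutral_right) (use I nn in \<open>force simp: P_def\<close>)+
  have pos: "sum f P > 0"
    by (rule sum_pos) (use P in \<open>auto simp: P_def\<close>)
  have "(\<Sum>i\<in>P. (1 / N) *\<^sub>R f i) powr p \<le> (\<Sum>i\<in>P. (1 / N) * f i powr p)"
    by (rule convex_on_sum[OF P(1,2) powr_convex[OF p]]) (use N in \<open>auto simp: N_def P_def\<close>)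
  then have "(sum f P / N) powr p \<le> (\<Sum>i\<in>P. f i powr p) / N"
    by (simp flip: sum_divide_distrib)
  then have "((sum f P / N) powr p) powr (1 / p) \<le> ((\<Sum>i\<in>P. f i powr p) / N) powr (1 / p)"
    by (rule powr_mono2[rotated 2]) (use p in auto)
  then have "sum f P / N \<le> (\<Sum>i\<in>P. f i powr p) powr (1 / p) / N powr (1 / p)"
    using p N pos by (simp add: powr_powr powr_divide sum_nonneg)
  then have "sum f P \<le> N * ((\<Sum>i\<in>P. f i powr p) powr (1 / p) / N powr (1 / p))"
    using N by (simp add: divide_le_eq mult.commute)
  also have "\<dots> = N powr (1 - 1 / p) * (\<Sum>i\<in>P. f i powr p) powr (1 / p)"
    using N by (simp add: powr_diff)
  also have "\<dots> \<le> card I powr (1 - 1 / p) * (\<Sum>i\<in>P. f i powr p) powr (1 / p)"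
    by (intro mult_right_mono powr_mono2) (use N NI p in auto)
  finally show ?thesis by (simp add: s1 s2)
qed

section \<open>Codes whose words agree in few positions\<close>

text \<open>Union bound over the sets \<open>T\<close> of exactly \<open>e\<close> positions on
  which \<open>w\<close> copies \<open>v\<close>. There are at most
  \<open>2 ^ (2 * e) = 4 ^ e\<close> such sets, and each leaves \<open>e\<close> free
  positions.\<close>

lemma card_words_agreeing:
  assumes "\<forall>l<2 * e. v l < (q::nat)"
  shows "card {w \<in> {..<2 * e} \<rightarrow>\<^sub>E {..<q}. e \<le> card {l\<in>{..<2 * e}. w l = v l}} \<le> 4 ^ e * q ^ e"
proof -
  define W where "W = ({..<2 * e} \<rightarrow>\<^sub>E {..<q})"
  define F where "F = {T. T \<subseteq> {..<2 * e} \<and> card T = e}"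
  define B where "B T = {w\<in>W. \<forall>l\<in>T. w l = v l}" for T
  have finW: "finite W" by (auto simp: W_def intro!: finite_PiE)
  have finF: "finite F" by (auto simp: F_def)
  have cB: "card (B T) = q ^ e" if "T \<in> F" for T
  proof -
    have T: "T \<subseteq> {..<2 * e}" "card T = e" using that by (auto simp: F_def)
    have "w \<in> B T \<longleftrightarrow> w \<in> (\<Pi>\<^sub>E l\<in>{..<2 * e}. if l \<in> T then {v l} else {..<q})" for w
    proof -
      have "(\<forall>l<2 * e. w l < q) \<and> (\<forall>l\<in>T. w l = v l)
          \<longleftrightarrow> (\<forall>l<2 * e. w l \<in> (if l \<in> T then {v l} else {..<q}))"
        using T(1) assms by (metis lessThan_iff singleton_iff subsetD)
      then show ?thesis by (auto simp only: B_def W_def PiE_iff lessThan_iff mem_Collect_eq)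
    qed
    then have "B T = (\<Pi>\<^sub>E l\<in>{..<2 * e}. if l \<in> T then {v l} else {..<q})" by blast
    then have "card (B T) = (\<Prod>l<2 * e. card (if l \<in> T then {v l} else {..<q}))"
      by (simp add: card_PiE)
    also have "\<dots> = (\<Prod>l<2 * e. if l \<in> T then 1 else q)"
      by (intro prod.cong) auto
    also have "\<dots> = (\<Prod>l\<in>{..<2 * e} - T. q)"
      by (rule prod.mono_neutral_cong_right) auto
    also have "\<dots> = q ^ card ({..<2 * e} - T)" by simp
    also have "card ({..<2 * e} - T) = e"
      using T by (simp add: card_Diff_subset finite_subset)
    finally show ?thesis .
  qed
  have sub: "{w \<in> W. e \<le> card {l\<in>{..<2 * e}. w l = v l}} \<subseteq> (\<Union>T\<in>F. B T)"
  proof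
    fix w assume w: "w \<in> {w \<in> W. e \<le> card {l\<in>{..<2 * e}. w l = v l}}"
    then obtain T where "T \<subseteq> {l\<in>{..<2 * e}. w l = v l}" "card T = e"
      using obtain_subset_with_card_n by (metis (no_types, lifting) mem_Collect_eq)
    then show "w \<in> (\<Union>T\<in>F. B T)" using w by (auto simp: F_def B_def)
  qed
  have "card F \<le> card (Pow {..<2 * e})" by (rule card_mono) (auto simp: F_def)
  then have cF: "card F \<le> 4 ^ e" by (simp add: card_Pow power_mult)
  have "card {w \<in> W. e \<le> card {l\<in>{..<2 * e}. w l = v l}} \<le> card (\<Union>T\<in>F. B T)"
    by (rule card_mono) (use sub finF finW in \<open>auto simp: B_def\<close>)
  also have "\<dots> \<le> (\<Sum>T\<in>F. card (B T))" by (rule card_UN_le[OF finF])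
  also have "\<dots> = card F * q ^ e" by (simp add: cB)
  also have "\<dots> \<le> 4 ^ e * q ^ e" using cF by simp
  finally show ?thesis by (simp add: W_def)
qed

text \<open>Gilbert--Varshamov: fewer than \<open>4 ^ e\<close> words rule out fewer than \<open>4 ^ e * (4 ^ e * 16 ^ e)\<close>,
  that is, not all, of the \<open>16 ^ (2 * e)\<close> candidates for the next one.\<close>
lemma exists_code:
  assumes "n \<le> 4 ^ e"
  shows "\<exists>c::nat \<Rightarrow> nat \<Rightarrow> nat. (\<forall>j<n. \<forall>l<2 * e. c j l < 16) \<and>
    (\<forall>i<n. \<forall>j<n. i \<noteq> j \<longrightarrow> card {l\<in>{..<2 * e}. c i l = c j l} \<le> e)"
  using assms
proof (induction n)
  case 0
  then show ?case by simp
next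
  case (Suc n)
  then obtain c :: "nat \<Rightarrow> nat \<Rightarrow> nat" where c1: "\<forall>j<n. \<forall>l<2 * e. c j l < 16"
    and c2: "\<forall>i<n. \<forall>j<n. i \<noteq> j \<longrightarrow> card {l\<in>{..<2 * e}. c i l = c j l} \<le> e"
    by auto
  define W where "W = ({..<2 * e} \<rightarrow>\<^sub>E {..<16::nat})"
  define B where "B j = {w \<in> W. e \<le> card {l\<in>{..<2 * e}. w l = c j l}}" for j
  have finW: "finite W" by (auto simp: W_def intro!: finite_PiE)
  have "card (\<Union>j\<in>{..<n}. B j) \<le> (\<Sum>j<n. card (B j))" by (rule card_UN_le) simp
  also have "\<dots> \<le> (\<Sum>j<n. 4 ^ e * 16 ^ e)"
    unfolding B_def W_def by (rule sum_mono, rule card_words_agreeing) (use c1 in auto)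
  also have "\<dots> < 4 ^ e * (4 ^ e * 16 ^ e)" using Suc.prems by simp
  \<comment> \<open>Both sides are \<open>256 ^ e\<close>.\<close>
  also have "\<dots> = card W"
    by (simp add: W_def card_PiE power_mult flip: power_mult_distrib)
  finally have "\<not> W \<subseteq> (\<Union>j\<in>{..<n}. B j)"
    using card_mono[of "\<Union>j\<in>{..<n}. B j" W] finW by (auto simp: B_def)
  then obtain w where w: "w \<in> W" "\<And>j. j < n \<Longrightarrow> w \<notin> B j" by auto
  have w2: "card {l\<in>{..<2 * e}. w l = c j l} \<le> e" if "j < n" for j
    using w(1) w(2)[OF that] by (simp add: B_def)
  have w3: "card {l\<in>{..<2 * e}. c j l = w l} \<le> e" if "j < n" for j
    using w2[OF that] by (simp add: eq_commute)
  have w1: "\<forall>l<2 * e. w l < 16" using w(1) by (auto simp: W_def PiE_iff)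
  show ?case
    by (rule exI[of _ "c(n := w)"]) (use c1 c2 w1 w2 w3 in \<open>auto simp: less_Suc_eq\<close>)
qed

section \<open>Collisions under a uniformly random hash function\<close>

text \<open>Two distinct points collide with probability exactly \<open>1 / m\<close>, stated
  without division. The colliding functions are classified by the common value \<open>a\<close>,
  which fixes two of the \<open>card I\<close> values.\<close>

lemma card_collisions:
  assumes "finite I" "i \<in> I" "j \<in> I" "i \<noteq> j"
  shows "m * card {g \<in> I \<rightarrow>\<^sub>E {..<m}. g i = g j} = card (I \<rightarrow>\<^sub>E {..<m})"
proof -
  define X where "X a = (\<Pi>\<^sub>E l\<in>I. if l \<in> {i, j} then {a} else {..<m})" for a
  have eq: "{g \<in> I \<rightarrow>\<^sub>E {..<m}. g i = g j} = (\<Union>a\<in>{..<m}. X a)" (is "?L = ?R")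
  proof (intro equalityI subsetI)
    fix g assume "g \<in> ?L"
    then have "g \<in> X (g i)" "g i < m" using assms by (auto simp: X_def PiE_iff)
    then show "g \<in> ?R" by auto
  next
    fix g assume "g \<in> ?R"
    then obtain a where a: "a < m" and g: "g \<in> X a" by auto
    have 1: "\<forall>l\<in>I. g l \<in> (if l \<in> {i, j} then {a} else {..<m})" "g \<in> extensional I"
      using g by (auto simp: X_def PiE_iff)
    then have "g i = a" "g j = a" using assms by auto
    moreover have "\<forall>l\<in>I. g l < m" using 1 a by (auto split: if_splits)
    ultimately show "g \<in> ?L" using 1 by (auto simp: PiE_iff)
  qed
  have dis: "X a \<inter> X b = {}" if "a \<noteq> b" for a b
    using assms that by (auto simp: X_def PiE_iff) (metis (full_types) singletonD)
  have cX: "card (X a) = m ^ card (I - {i, j})" for a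
  proof -
    have "card (X a) = (\<Prod>l\<in>I. card (if l \<in> {i, j} then {a} else {..<m}))"
      unfolding X_def using assms by (simp add: card_PiE)
    also have "\<dots> = (\<Prod>l\<in>I. if l \<in> {i, j} then 1 else m)" by (intro prod.cong) auto
    also have "\<dots> = (\<Prod>l\<in>I - {i, j}. m)"
      by (rule prod.mono_neutral_cong_right) (use assms in auto)
    finally show ?thesis by simp
  qed
  have "card {g \<in> I \<rightarrow>\<^sub>E {..<m}. g i = g j} = (\<Sum>a<m. card (X a))"
    unfolding eq by (rule card_UN_disjoint) (use assms dis in \<open>auto simp: X_def intro!: finite_PiE\<close>)
  also have "\<dots> = m * m ^ card (I - {i, j})" by (simp add: cX)
  finally have "m * card {g \<in> I \<rightarrow>\<^sub>E {..<m}. g i = g j} = m ^ Suc (Suc (card (I - {i, j})))" by simp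
  also have "Suc (Suc (card (I - {i, j}))) = card I"
  proof -
    have "card (I - {i, j}) = card I - 2" using assms by (simp add: card_Diff_subset)
    \<comment> \<open>This rules out truncation in the natural subtraction
      \<open>card I - 2\<close>.\<close>
    moreover have "card {i, j} \<le> card I" by (rule card_mono) (use assms in auto)
    ultimately show ?thesis using assms by auto
  qed
  finally show ?thesis using assms by (simp add: card_PiE)
qed

section \<open>Noise in a bucket and the number of heavy coordinates\<close>

definition noise :: "nat \<Rightarrow> real vec \<Rightarrow> (nat \<Rightarrow> nat) \<Rightarrow> nat \<Rightarrow> real" where
  "noise n x g i = (\<Sum>j\<in>{j\<in>{..<n} - {i}. g i = g j}. x $ j)"

text \<open>Markov's inequality in counting form: each other entry lands in the bucket of
  \<open>i\<close> with probability \<open>1 / m\<close>, so the mean noise is at most the total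
  mass divided by \<open>m\<close>, hence at most \<open>t / 4\<close>.\<close>

lemma card_noisy_le:
  assumes i: "i < n" and nn: "\<forall>j<n. 0 \<le> x $ j" and t: "0 < t"
    and m: "4 * (\<Sum>j<n. x $ j) \<le> t * real m" and m0: "0 < m"
  shows "4 * card {g \<in> {..<n} \<rightarrow>\<^sub>E {..<m}. t < noise n x g i} \<le> card ({..<n} \<rightarrow>\<^sub>E {..<m})"
proof -
  define G where "G = ({..<n} \<rightarrow>\<^sub>E {..<m})"
  define B where "B = {g \<in> G. t < noise n x g i}"
  have finG: "finite G" by (auto simp: G_def intro!: finite_PiE)
  have nz: "0 \<le> noise n x g i" for g
    unfolding noise_def by (rule sum_nonneg) (use nn in auto)
  have "t * card B = (\<Sum>g\<in>B. t)" by simp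
  also have "\<dots> \<le> (\<Sum>g\<in>B. noise n x g i)" by (rule sum_mono) (auto simp: B_def)
  also have "\<dots> \<le> (\<Sum>g\<in>G. noise n x g i)"
    by (rule sum_mono2) (use finG nz in \<open>auto simp: B_def\<close>)
  also have "\<dots> = (\<Sum>g\<in>G. \<Sum>j\<in>{..<n} - {i}. if g i = g j then x $ j else 0)"
    unfolding noise_def by (intro sum.cong refl sum.inter_filter) auto
  also have "\<dots> = (\<Sum>j\<in>{..<n} - {i}. \<Sum>g\<in>G. if g i = g j then x $ j else 0)"
    by (rule sum.swap)
  also have "\<dots> = (\<Sum>j\<in>{..<n} - {i}. real (card {g\<in>G. g i = g j}) * x $ j)"
    using finG by (intro sum.cong refl) (simp flip: sum.inter_filter)
  \<comment> \<open>The factor \<open>m\<close> allows the collision counts to be replaced by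
    \<open>card G\<close>.\<close>
  finally have "real m * (t * card B) \<le> real m * (\<Sum>j\<in>{..<n} - {i}. real (card {g\<in>G. g i = g j}) * x $ j)"
    by (simp add: mult_left_mono)
  also have "\<dots> = (\<Sum>j\<in>{..<n} - {i}. real (m * card {g\<in>G. g i = g j}) * x $ j)"
    by (simp add: sum_distrib_left mult.assoc)
  also have "\<dots> = (\<Sum>j\<in>{..<n} - {i}. real (card G) * x $ j)"
    by (intro sum.cong refl) (use i card_collisions[of "{..<n}" i _ m] in \<open>auto simp: G_def\<close>)
  also have "\<dots> \<le> (\<Sum>j<n. real (card G) * x $ j)"
    by (rule sum_mono2) (use nn in auto)
  also have "\<dots> = real (card G) * (\<Sum>j<n. x $ j)" by (simp add: sum_distrib_left)
  finally have "4 * (real m * (t * card B)) \<le> real (card G) * (4 * (\<Sum>j<n. x $ j))" by simp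
  also have "\<dots> \<le> real (card G) * (t * real m)" by (rule mult_left_mono[OF m]) simp
  finally have "(t * real m) * (4 * card B) \<le> (t * real m) * card G" by (simp add: mult_ac)
  then have "real (4 * card B) \<le> card G"
    using t m0 by (subst (asm) mult_le_cancel_left_pos) auto
  then show ?thesis unfolding B_def G_def by linarith
qed

text \<open>Each heavy entry contributes at least a fraction \<open>\<epsilon> powr p\<close> of the
  sum of the p-th powers.\<close>

lemma card_heavy_le:
  assumes nn: "\<forall>j<n. 0 \<le> x $ j" and p: "1 \<le> p" and e: "0 < \<epsilon>" and dim: "dim_vec x = n"
  shows "real (card {i\<in>{..<n}. \<epsilon> * lp_norm p x < x $ i}) * \<epsilon> powr p \<le> 1"
proof -
  define S where "S = {i\<in>{..<n}. \<epsilon> * lp_norm p x < x $ i}"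
  define N where "N = (\<Sum>i<n. (x $ i) powr p)"
  have N: "N = (\<Sum>i<n. \<bar>x $ i\<bar> powr p)" unfolding N_def using nn by (intro sum.cong) auto
  have N0: "N \<ge> 0" by (simp add: N_def sum_nonneg)
  have L: "lp_norm p x powr p = N" "0 \<le> lp_norm p x"
    using p dim N0 by (simp_all add: lp_norm_def powr_powr flip: N)
  show ?thesis
  proof (cases "S = {}")
    case True
    then show ?thesis by (simp only: S_def [symmetric] card.empty of_nat_0 mult_zero_left zero_le_one)
  next
    case False
    then obtain i where i: "i < n" "\<epsilon> * lp_norm p x < x $ i" by (auto simp: S_def)
    have xi: "0 < x $ i" using i L e by (smt (verit) mult_nonneg_nonneg)
    have "0 < x $ i powr p" using xi by simp
    also have "\<dots> \<le> N" unfolding N_def by (rule member_le_sum) (use i in auto)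
    \<comment> \<open>A heavy entry is positive, so the norm does not vanish and \<open>N\<close>
      can be cancelled.\<close>
    finally have Npos: "0 < N" .
    have "real (card S) * \<epsilon> powr p * N = (\<Sum>j\<in>S. (\<epsilon> * lp_norm p x) powr p)"
      using e L by (simp add: powr_mult)
    also have "\<dots> \<le> (\<Sum>j\<in>S. x $ j powr p)"
      by (intro sum_mono powr_mono2) (use p e L in \<open>auto simp: S_def\<close>)
    also have "\<dots> \<le> N" unfolding N_def by (rule sum_mono2) (auto simp: S_def)
    finally show ?thesis using Npos by (simp add: S_def)
  qed
qed

section \<open>The measurement matrix and its lower bound on consistent vectors\<close>

text \<open>Each bucket \<open>(r, b)\<close> of the hash family \<open>h\<close> has one counter for every position and symbol
  of the code words \<open>c j\<close>; \<open>\<phi>\<close> enumerates the counters.\<close>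
definition sketch_mat ::
  "nat \<Rightarrow> nat \<Rightarrow> (nat \<Rightarrow> nat \<times> nat \<times> nat \<times> nat) \<Rightarrow> (nat \<Rightarrow> nat \<Rightarrow> nat) \<Rightarrow> (nat \<Rightarrow> nat \<Rightarrow> nat) \<Rightarrow> real mat" where
  "sketch_mat k n \<phi> c h = mat k n (\<lambda>(t, j). case \<phi> t of (r, b, l, a) \<Rightarrow>
     if h r j = b \<and> c j l = a then 1 else 0)"

lemma sketch_mat_carrier [simp]: "sketch_mat k n \<phi> c h \<in> carrier_mat k n"
  by (simp add: sketch_mat_def)

lemma sketch_mat_mult:
  assumes "t < k" "\<phi> t = (r, b, l, a)" "dim_vec x = n"
  shows "(sketch_mat k n \<phi> c h *\<^sub>v x) $ t = (\<Sum>j\<in>{j\<in>{..<n}. h r j = b \<and> c j l = a}. x $ j)"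
proof -
  have "(sketch_mat k n \<phi> c h *\<^sub>v x) $ t
      = (\<Sum>j<n. (if h r j = b \<and> c j l = a then 1 else 0) * x $ j)"
    using assms by (simp add: sketch_mat_def scalar_prod_def lessThan_atLeast0)
  also have "\<dots> = (\<Sum>j<n. if h r j = b \<and> c j l = a then x $ j else 0)"
    by (intro sum.cong) auto
  also have "\<dots> = (\<Sum>j\<in>{j\<in>{..<n}. h r j = b \<and> c j l = a}. x $ j)"
    by (rule sum.inter_filter[symmetric]) simp
  finally show ?thesis .
qed

text \<open>In the bucket of \<open>i\<close>, the counters selected by the code word of \<open>i\<close> add up to the sum of the
  entries weighted by the numbers \<open>\<alpha> j\<close> of agreeing positions. Subtracting \<open>e\<close> times the total
  mass of the bucket leaves the weight \<open>e\<close> on entry \<open>i\<close> and a weight in \<open>[- e, 0]\<close> on the others.\<close>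
lemma sketch_mat_lower_bound:
  assumes surj: "{..<d} \<times> {..<m} \<times> {..<2 * e} \<times> {..<q} \<subseteq> \<phi> ` {..<k}"
    and e: "0 < e" and c: "\<forall>j<n. \<forall>l<2 * e. c j l < q"
    and code: "\<forall>i<n. \<forall>j<n. i \<noteq> j \<longrightarrow> card {l\<in>{..<2 * e}. c i l = c j l} \<le> e"
    and r: "r < d" and hi: "h r i < m" and i: "i < n"
    and x: "dim_vec x = n" "\<forall>j<n. 0 \<le> x $ j" and z: "dim_vec z = n" "\<forall>j<n. 0 \<le> z $ j"
    and eq: "sketch_mat k n \<phi> c h *\<^sub>v z = sketch_mat k n \<phi> c h *\<^sub>v x"
  shows "x $ i - noise n x (h r) i \<le> z $ i"
proof -
  define B where "B = {j\<in>{..<n}. h r j = h r i}"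
  define \<alpha> where "\<alpha> j = card {l\<in>{..<2 * e}. c i l = c j l}" for j
  have finB: "finite B" by (simp add: B_def)
  have iB: "i \<in> B" using i by (simp add: B_def)
  have cnt: "(\<Sum>j\<in>{j\<in>B. c j l = a}. z $ j) = (\<Sum>j\<in>{j\<in>B. c j l = a}. x $ j)"
    if "l < 2 * e" "a < q" for l a
  proof -
    have "(r, h r i, l, a) \<in> \<phi> ` {..<k}" using surj that r hi by auto
    then obtain t where t: "t < k" "\<phi> t = (r, h r i, l, a)" by auto
    have "{j\<in>B. c j l = a} = {j\<in>{..<n}. h r j = h r i \<and> c j l = a}" by (auto simp: B_def)
    then show ?thesis
      using sketch_mat_mult[of t k \<phi> r "h r i" l a z n c h]
        sketch_mat_mult[of t k \<phi> r "h r i" l a x n c h] t x z eq by simp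
  qed
  \<comment> \<open>The symbols at any one position partition the bucket, so its mass is a sum of
    counters. Position 0 exists because \<open>e\<close> is positive.\<close>
  have tot: "(\<Sum>j\<in>B. z $ j) = (\<Sum>j\<in>B. x $ j)"
  proof -
    have im: "(\<lambda>j. c j 0) ` B \<subseteq> {..<q}" using c e by (auto simp: B_def)
    have "(\<Sum>j\<in>B. z $ j) = (\<Sum>a<q. \<Sum>j\<in>{j\<in>B. c j 0 = a}. z $ j)"
      by (rule sum.group[symmetric, OF finB _ im]) simp
    also have "\<dots> = (\<Sum>a<q. \<Sum>j\<in>{j\<in>B. c j 0 = a}. x $ j)"
      by (rule sum.cong) (use e cnt in auto)
    also have "\<dots> = (\<Sum>j\<in>B. x $ j)"
      by (rule sum.group[OF finB _ im]) simp
    finally show ?thesis .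
  qed
  \<comment> \<open>Double counting of the pairs of an entry \<open>j\<close> and a position where
    its word agrees with that of \<open>i\<close>. The right side consists of counters, on which
    \<open>x\<close> and \<open>z\<close> coincide.\<close>
  have pos: "(\<Sum>j\<in>B. real (\<alpha> j) * y $ j) = (\<Sum>l<2 * e. \<Sum>j\<in>{j\<in>B. c j l = c i l}. y $ j)" for y
  proof -
    have "(\<Sum>j\<in>B. real (\<alpha> j) * y $ j) = (\<Sum>j\<in>B. \<Sum>l<2 * e. if c j l = c i l then y $ j else 0)"
      by (intro sum.cong refl) (simp add: \<alpha>_def eq_commute flip: sum.inter_filter)
    also have "\<dots> = (\<Sum>l<2 * e. \<Sum>j\<in>B. if c j l = c i l then y $ j else 0)" by (rule sum.swap)
    also have "\<dots> = (\<Sum>l<2 * e. \<Sum>j\<in>{j\<in>B. c j l = c i l}. y $ j)"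
      using finB by (simp add: sum.inter_filter)
    finally show ?thesis .
  qed
  have agr: "(\<Sum>j\<in>B. real (\<alpha> j) * z $ j) = (\<Sum>j\<in>B. real (\<alpha> j) * x $ j)"
    unfolding pos by (rule sum.cong) (use c i cnt in auto)
  have cert: "(\<Sum>j\<in>B. (real (\<alpha> j) - e) * z $ j) = (\<Sum>j\<in>B. (real (\<alpha> j) - e) * x $ j)"
    by (simp add: left_diff_distrib sum_subtractf agr tot flip: sum_distrib_left)
  \<comment> \<open>The word of \<open>i\<close> agrees with itself in all \<open>2 * e\<close>
    positions, which leaves weight \<open>e\<close> on entry \<open>i\<close>.\<close>
  have split: "(\<Sum>j\<in>B. (real (\<alpha> j) - e) * y $ j) = e * y $ i + (\<Sum>j\<in>B - {i}. (real (\<alpha> j) - e) * y $ j)"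
    for y :: "real vec"
    by (subst sum.remove[OF finB iB]) (simp add: \<alpha>_def)
  have "(\<Sum>j\<in>B - {i}. (real (\<alpha> j) - e) * z $ j) \<le> 0"
    by (rule sum_nonpos, rule mult_nonpos_nonneg) (use code i z in \<open>auto simp: B_def \<alpha>_def\<close>)
  moreover have "- (e * noise n x (h r) i) \<le> (\<Sum>j\<in>B - {i}. (real (\<alpha> j) - e) * x $ j)"
  proof -
    have "B - {i} = {j\<in>{..<n} - {i}. h r i = h r j}" by (auto simp: B_def)
    then have "- (e * noise n x (h r) i) = (\<Sum>j\<in>B - {i}. - (e * x $ j))"
      by (simp add: noise_def sum_negf sum_distrib_left)
    also have "\<dots> \<le> (\<Sum>j\<in>B - {i}. (real (\<alpha> j) - e) * x $ j)"
      by (rule sum_mono) (use x in \<open>auto simp: B_def left_diff_distrib\<close>)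
    finally show ?thesis .
  qed
  ultimately have "e * x $ i - e * noise n x (h r) i \<le> e * z $ i"
    using cert split[of z] split[of x] by linarith
  then have "e * (x $ i - noise n x (h r) i) \<le> e * z $ i" by (simp add: right_diff_distrib)
  then show ?thesis using e by simp
qed

section \<open>Recovery\<close>

text \<open>Each coordinate is minimized by a separate linear program, so the resulting vector need
  not be consistent itself. If \<open>y\<close> is the sketch of no nonnegative vector, the value is
  the default \<open>Inf {}\<close>; the bounds below concern only \<open>y = A *\<^sub>v x\<close>
  with \<open>x\<close> nonnegative, where \<open>x\<close> is a candidate.\<close>

definition least_consistent :: "nat \<Rightarrow> real mat \<Rightarrow> real vec \<Rightarrow> real vec" where
  "least_consistent n A y = vec n (\<lambda>i. Inf {z $ i | z. z \<in> carrier_vec n \<and> (\<forall>j<n. 0 \<le> z $ j) \<and> A *\<^sub>v z = y})"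

lemma least_consistent_le:
  assumes "x \<in> carrier_vec n" "\<forall>j<n. 0 \<le> x $ j" "i < n"
  shows "least_consistent n A (A *\<^sub>v x) $ i \<le> x $ i"
  unfolding least_consistent_def using assms
  by (auto intro!: cInf_lower bdd_belowI[of _ 0])

lemma least_consistent_ge:
  assumes "x \<in> carrier_vec n" "\<forall>j<n. 0 \<le> x $ j" "i < n"
    and "\<And>z. z \<in> carrier_vec n \<Longrightarrow> \<forall>j<n. 0 \<le> z $ j \<Longrightarrow> A *\<^sub>v z = A *\<^sub>v x \<Longrightarrow> b \<le> z $ i"
  shows "b \<le> least_consistent n A (A *\<^sub>v x) $ i"
  unfolding least_consistent_def using assms
  by (auto intro!: cInf_greatest)

section \<open>Independent hash functions and the failure probability\<close>

text \<open>Extensional functions make this a finite product, so a uniform element amounts to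
  \<open>d\<close> independent uniform hash functions.\<close>

definition hash_families :: "nat \<Rightarrow> nat \<Rightarrow> nat \<Rightarrow> (nat \<Rightarrow> nat \<Rightarrow> nat) set" where
  "hash_families d n m = ({..<d} \<rightarrow>\<^sub>E ({..<n} \<rightarrow>\<^sub>E {..<m}))"

lemma finite_hash_families [simp]: "finite (hash_families d n m)"
  by (auto simp: hash_families_def intro!: finite_PiE)

text \<open>A fixed heavy coordinate is noisy under all \<open>d\<close> functions with probability
  at most \<open>1 / 4 ^ d\<close>. A union bound over at most \<open>\<epsilon> powr (- p)\<close>
  heavy coordinates gives failure probability at most \<open>1 / 10\<close>.\<close>

lemma card_unlucky_le:
  assumes nn: "\<forall>j<n. 0 \<le> x $ j" and dim: "dim_vec x = n" and p: "1 \<le> p" and e: "0 < \<epsilon>" "\<epsilon> < 1"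
    and m: "4 * real n powr (1 - 1 / p) \<le> \<epsilon> * real m" and m0: "0 < m"
    and d: "p * ln (1 / \<epsilon>) + 3 \<le> real d"
  shows "10 * real (card {h \<in> hash_families d n m.
      \<exists>i<n. \<epsilon> * lp_norm p x < x $ i \<and> (\<forall>r<d. \<epsilon> * lp_norm p x < noise n x (h r) i)})
    \<le> real (card (hash_families d n m))"
proof -
  define t where "t = \<epsilon> * lp_norm p x"
  define S where "S = {i\<in>{..<n}. t < x $ i}"
  define G where "G = ({..<n} \<rightarrow>\<^sub>E {..<m})"
  define U where "U i = {g\<in>G. t < noise n x g i}" for i
  have finG: "finite G" by (auto simp: G_def intro!: finite_PiE)
  have t0: "0 \<le> t" using e by (simp add: t_def lp_norm_def)
  have bad: "4 ^ d * card ({..<d} \<rightarrow>\<^sub>E U i) \<le> card (hash_families d n m)" if i: "i \<in> S" for i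
  proof -
    \<comment> \<open>Markov's inequality needs a positive threshold. With \<open>t = 0\<close> the
      vector would be zero and have no heavy coordinate.\<close>
    have tpos: "0 < t"
    proof (rule ccontr)
      assume "\<not> 0 < t"
      then have "t = 0" using t0 by simp
      then have "lp_norm p x = 0" using e by (simp add: t_def)
      then have "(\<Sum>j<n. \<bar>x $ j\<bar> powr p) = 0" using dim by (simp add: lp_norm_def)
      then have "\<forall>j<n. x $ j = 0" by (subst (asm) sum_nonneg_eq_0_iff) auto
      then show False using i t0 by (auto simp: S_def)
    qed
    have "(\<Sum>j<n. x $ j) \<le> real (card {..<n}) powr (1 - 1 / p) * (\<Sum>j<n. x $ j powr p) powr (1 / p)"
      by (rule sum_le_card_powr_mult_lp) (use nn p in auto)
    also have "(\<Sum>j<n. x $ j powr p) = (\<Sum>j<n. \<bar>x $ j\<bar> powr p)"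
      using nn by (intro sum.cong) auto
    finally have "(\<Sum>j<n. x $ j) \<le> real n powr (1 - 1 / p) * lp_norm p x"
      by (simp add: lp_norm_def dim)
    then have "4 * (\<Sum>j<n. x $ j) \<le> (4 * real n powr (1 - 1 / p)) * lp_norm p x" by simp
    also have "\<dots> \<le> (\<epsilon> * real m) * lp_norm p x"
      by (rule mult_right_mono[OF m]) (simp add: lp_norm_def)
    also have "\<dots> = t * real m" by (simp add: t_def)
    finally have "4 * card (U i) \<le> card G"
      unfolding U_def G_def by (intro card_noisy_le) (use i nn m0 tpos in \<open>auto simp: S_def\<close>)
    \<comment> \<open>Independence: the families that are noisy for \<open>i\<close> throughout form
      a d-fold product of \<open>U i\<close>.\<close>
    then have "(4 * card (U i)) ^ d \<le> card G ^ d" by (rule power_mono) simp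
    then show ?thesis
      by (simp add: hash_families_def card_PiE power_mult_distrib flip: G_def)
  qed
  have sub: "{h \<in> hash_families d n m. \<exists>i<n. t < x $ i \<and> (\<forall>r<d. t < noise n x (h r) i)}
      \<subseteq> (\<Union>i\<in>S. {..<d} \<rightarrow>\<^sub>E U i)" (is "?B \<subseteq> _")
    by (force simp: hash_families_def S_def U_def PiE_iff simp flip: G_def)
  have "card ?B \<le> card (\<Union>i\<in>S. {..<d} \<rightarrow>\<^sub>E U i)"
    by (rule card_mono[OF _ sub]) (use finG in \<open>auto simp: S_def U_def intro!: finite_PiE\<close>)
  also have "\<dots> \<le> (\<Sum>i\<in>S. card ({..<d} \<rightarrow>\<^sub>E U i))" by (rule card_UN_le) (simp add: S_def)
  finally have "4 ^ d * card ?B \<le> (\<Sum>i\<in>S. 4 ^ d * card ({..<d} \<rightarrow>\<^sub>E U i))"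
    by (simp flip: sum_distrib_left)
  also have "\<dots> \<le> (\<Sum>i\<in>S. card (hash_families d n m))" by (rule sum_mono) (rule bad)
  finally have "real (4 ^ d * card ?B) \<le> real (card S * card (hash_families d n m))"
    by (simp only: of_nat_le_iff) simp
  then have 1: "4 ^ d * real (card ?B) \<le> real (card S) * card (hash_families d n m)" by simp
  have heavy: "real (card S) * \<epsilon> powr p \<le> 1"
    unfolding S_def t_def by (rule card_heavy_le) (use nn p e dim in auto)
  \<comment> \<open>The summand 3 in the bound on \<open>d\<close> pays for the factor 10, since
    \<open>exp 3\<close> is at least 10; base 4 exceeds \<open>exp 1\<close>.\<close>
  have "10 * \<epsilon> powr (- p) \<le> 4 ^ d"
  proof -
    have e4: "exp (1::real) \<le> 4" using e_less_272 by simp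
    have "5 / 2 \<le> exp (1::real)" using exp_lower_Taylor_quadratic[of 1] by simp
    then have "(5 / 2) ^ 3 \<le> exp (1::real) ^ 3" by (rule power_mono) simp
    then have e10: "10 \<le> exp (3::real)" by (simp add: power3_eq_cube flip: exp_add)
    have "10 * \<epsilon> powr (- p) \<le> exp 3 * exp (p * ln (1 / \<epsilon>))"
      using e e10 by (simp add: powr_def ln_div)
    also have "\<dots> \<le> exp (real d)" using d by (simp flip: exp_add)
    also have "\<dots> = exp 1 ^ d" by (simp add: exp_of_nat_mult[of d 1, simplified])
    also have "\<dots> \<le> 4 ^ d" by (rule power_mono[OF e4]) simp
    finally show ?thesis .
  qed
  then have "10 * (\<epsilon> powr (- p) * \<epsilon> powr p) \<le> 4 ^ d * \<epsilon> powr p"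
    by (simp add: mult_right_mono flip: mult.assoc)
  then have 2: "10 \<le> 4 ^ d * \<epsilon> powr p" using e by (simp flip: powr_add)
  have "10 * real (card ?B) \<le> (4 ^ d * \<epsilon> powr p) * real (card ?B)"
    by (rule mult_right_mono[OF 2]) simp
  also have "\<dots> = (4 ^ d * real (card ?B)) * \<epsilon> powr p" by simp
  also have "\<dots> \<le> (real (card S) * card (hash_families d n m)) * \<epsilon> powr p"
    by (rule mult_right_mono[OF 1]) simp
  also have "\<dots> = (real (card S) * \<epsilon> powr p) * card (hash_families d n m)" by simp
  also have "\<dots> \<le> 1 * real (card (hash_families d n m))" by (rule mult_right_mono[OF heavy]) simp
  finally show ?thesis by (simp add: t_def)
qed

section \<open>Assembling the sketch\<close>

text \<open>The dimension counts \<open>d\<close> hash functions, \<open>m\<close> buckets,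
  \<open>2 * e\<close> positions and 16 symbols. Only the hash family is random; the code and the
  enumeration of the counters are fixed in advance.\<close>

lemma sketch_exists:
  assumes p: "1 \<le> p" and \<epsilon>: "0 < \<epsilon>" "\<epsilon> < 1"
    and m: "4 * real n powr (1 - 1 / p) \<le> \<epsilon> * real m" and m0: "0 < m"
    and d: "p * ln (1 / \<epsilon>) + 3 \<le> real d" and e: "0 < e" "n \<le> 4 ^ e"
  shows "\<exists>M R. linear_sketch (d * m * (2 * e) * 16) n M R \<and>
      (\<forall>x\<in>carrier_vec n. (\<forall>i<n. 0 \<le> x $ i) \<longrightarrow>
        (\<forall>A\<in>space M. \<forall>i<n. R A (A *\<^sub>v x) $ i \<le> x $ i) \<and>
        \<P>(A in M. \<forall>i<n. R A (A *\<^sub>v x) $ i \<ge> x $ i - \<epsilon> * lp_norm p x) \<ge> 9 / 10)"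
proof -
  define k where "k = d * m * (2 * e) * 16"
  define H where "H = hash_families d n m"
  obtain c :: "nat \<Rightarrow> nat \<Rightarrow> nat" where c: "\<forall>j<n. \<forall>l<2 * e. c j l < 16"
    and code: "\<forall>i<n. \<forall>j<n. i \<noteq> j \<longrightarrow> card {l\<in>{..<2 * e}. c i l = c j l} \<le> e"
    using exists_code[OF e(2)] by blast
  define Q where "Q = {..<d} \<times> {..<m} \<times> {..<2 * e} \<times> {..<16::nat}"
  have "finite Q" "card Q = k" by (simp_all add: Q_def k_def card_cartesian_product)
  then obtain \<phi> where "bij_betw \<phi> {..<k} Q"
    using ex_bij_betw_nat_finite[of Q] by (auto simp: lessThan_atLeast0)
  then have surj: "Q \<subseteq> \<phi> ` {..<k}" by (simp add: bij_betw_def)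
  define f where "f = sketch_mat k n \<phi> c"
  \<comment> \<open>The law is the image of the uniform distribution on \<open>H\<close>. Taking all
    subsets of the finite image as events makes every real function of the matrix
    measurable.\<close>
  define M where "M = distr (uniform_count_measure H) (count_space (f ` H)) f"
  define R where "R = least_consistent n"
  have finH: "finite H" by (simp add: H_def)
  have "(\<lambda>r\<in>{..<d}. \<lambda>j\<in>{..<n}. 0) \<in> H" using m0 by (auto simp: H_def hash_families_def)
  then have Hne: "H \<noteq> {}" by auto
  interpret H: prob_space "uniform_count_measure H"
    by (rule prob_space_uniform_count_measure[OF finH Hne])
  have fm: "f \<in> uniform_count_measure H \<rightarrow>\<^sub>M count_space (f ` H)"
    by (auto simp: measurable_def space_uniform_count_measure sets_uniform_count_measure)
  interpret M: prob_space M unfolding M_def by (rule H.prob_space_distr[OF fm])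
  have spM: "space M = f ` H" by (simp add: M_def)
  have meas: "g \<in> borel_measurable M" for g :: "real mat \<Rightarrow> real" by (simp add: M_def)
  have sk: "linear_sketch k n M R"
    unfolding linear_sketch_def
    by (auto simp: spM f_def R_def least_consistent_def M.prob_space_axioms intro: meas)
  have up: "\<forall>A\<in>space M. \<forall>i<n. R A (A *\<^sub>v x) $ i \<le> x $ i"
    if "x \<in> carrier_vec n" "\<forall>i<n. 0 \<le> x $ i" for x
    using that least_consistent_le by (simp add: R_def)
  have prob: "9 / 10 \<le> \<P>(A in M. \<forall>i<n. R A (A *\<^sub>v x) $ i \<ge> x $ i - \<epsilon> * lp_norm p x)"
    if x: "x \<in> carrier_vec n" "\<forall>i<n. 0 \<le> x $ i" for x
  proof -
    have dim: "dim_vec x = n" using x by simp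
    define t where "t = \<epsilon> * lp_norm p x"
    define B where "B = {h \<in> H. \<exists>i<n. t < x $ i \<and> (\<forall>r<d. t < noise n x (h r) i)}"
    define E where "E = {h \<in> H. \<forall>i<n. R (f h) (f h *\<^sub>v x) $ i \<ge> x $ i - t}"
    \<comment> \<open>The only random event is avoiding \<open>B\<close>; from there on the lower
      bound is deterministic.\<close>
    have "H - B \<subseteq> E"
    proof
      fix h assume h: "h \<in> H - B"
      have "x $ i - t \<le> R (f h) (f h *\<^sub>v x) $ i" if i: "i < n" for i
        unfolding R_def
      proof (rule least_consistent_ge[OF x i])
        fix z :: "real vec" assume z: "z \<in> carrier_vec n" "\<forall>j<n. 0 \<le> z $ j" "f h *\<^sub>v z = f h *\<^sub>v x"
        show "x $ i - t \<le> z $ i"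
        proof (cases "t < x $ i")
          \<comment> \<open>A light coordinate needs no hashing: \<open>x $ i - t\<close> is at most
            0, and \<open>z $ i\<close> is nonnegative.\<close>
          case False
          then show ?thesis using z i by (smt (verit))
        next
          case True
          then obtain r where r: "r < d" "noise n x (h r) i \<le> t"
            using h i by (force simp: B_def)
          have "h r i < m" using h r i by (auto simp: H_def hash_families_def PiE_iff)
          then have "x $ i - noise n x (h r) i \<le> z $ i"
            using z dim x i r e c code surj unfolding Q_def f_def
            by (intro sketch_mat_lower_bound[of d m e 16 \<phi> k n c]) auto
          then show ?thesis using r by simp
        qed
      qed
      then show "h \<in> E" using h by (simp add: E_def)
    qed
    then have "card (H - B) \<le> card E" by (rule card_mono[rotated]) (simp add: E_def finH)
    moreover have "card (H - B) = card H - card B"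
      by (rule card_Diff_subset) (auto simp: B_def finH)
    moreover have "10 * real (card B) \<le> card H"
      unfolding B_def H_def t_def by (rule card_unlucky_le) (use x dim p \<epsilon> m m0 d in auto)
    ultimately have "9 / 10 * real (card H) \<le> card E" by linarith
    moreover have "0 < card H" using finH Hne by (simp add: card_gt_0_iff)
    ultimately have "9 / 10 \<le> real (card E) / card H" by (simp add: le_divide_eq)
    also have "\<dots> = measure (uniform_count_measure H) E"
      by (rule measure_uniform_count_measure[symmetric]) (auto simp: finH E_def)
    also have "E = f -` {A \<in> space M. \<forall>i<n. R A (A *\<^sub>v x) $ i \<ge> x $ i - t} \<inter> space (uniform_count_measure H)"
      by (auto simp: E_def spM space_uniform_count_measure)
    also have "measure (uniform_count_measure H) \<dots> = \<P>(A in M. \<forall>i<n. R A (A *\<^sub>v x) $ i \<ge> x $ i - t)"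
      unfolding M_def by (rule measure_distr[symmetric, OF fm]) auto
    finally show ?thesis by (simp add: t_def)
  qed
  show ?thesis using sk up prob unfolding k_def by blast
qed

section \<open>Choice of parameters and the dimension bound\<close>

theorem mainTheorem10:
  shows "\<exists>C>0. \<forall>(p::real) (\<epsilon>::real) (n::nat).
    1 \<le> p \<longrightarrow> 0 < \<epsilon> \<longrightarrow> \<epsilon> < 1 \<longrightarrow> 1 \<le> n \<longrightarrow>
    (\<exists>(k::nat) (M::real mat measure) (R::real mat \<Rightarrow> real vec \<Rightarrow> real vec).
      real k \<le> C * (p * (1 / \<epsilon>) * log_ge1 (1 / \<epsilon>) * real n powr (1 - 1 / p) * log_ge1 (real n)) \<and>
      linear_sketch k n M R \<and>
      (\<forall>x\<in>carrier_vec n. (\<forall>i<n. 0 \<le> x $ i) \<longrightarrow>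
        (\<forall>A\<in>space M. \<forall>i<n. R A (A *\<^sub>v x) $ i \<le> x $ i) \<and>
        \<P>(A in M. \<forall>i<n. R A (A *\<^sub>v x) $ i \<ge> x $ i - \<epsilon> * lp_norm p x) \<ge> 9 / 10))"
\<comment> \<open>The constant is \<open>32 * 5 * 5 * 3\<close>: the factor 32 comes from
  \<open>2 * 16\<close>, and the others from the bounds on \<open>d\<close>, \<open>m\<close> and
  \<open>e\<close>.\<close>
proof (rule exI[of _ 2400], intro conjI allI impI)
  fix p \<epsilon> :: real and n :: nat
  assume p: "1 \<le> p" and \<epsilon>: "0 < \<epsilon>" "\<epsilon> < 1" and n: "1 \<le> n"
  define N where "N = real n powr (1 - 1 / p)"
  define L where "L = log_ge1 (1 / \<epsilon>)"
  define K where "K = log_ge1 (real n)"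
  define m where "m = nat \<lceil>4 * N / \<epsilon>\<rceil>"
  define d where "d = nat \<lceil>p * ln (1 / \<epsilon>) + 3\<rceil>"
  \<comment> \<open>The added 1 keeps \<open>e\<close> positive for \<open>n = 1\<close>. The
    natural logarithm suffices because \<open>exp 1\<close> is at most 4.\<close>
  define e where "e = nat \<lceil>ln (real n)\<rceil> + 1"
  have N1: "1 \<le> N" unfolding N_def using n p by (intro ge_one_powr_ge_zero) auto
  have L: "1 \<le> L" "ln (1 / \<epsilon>) \<le> L" by (simp_all add: L_def log_ge1_def)
  have K: "1 \<le> K" "ln (real n) \<le> K" by (simp_all add: K_def log_ge1_def)
  have ln0: "0 \<le> ln (1 / \<epsilon>)" "0 \<le> ln (real n)" using \<epsilon> n by auto
  have pL: "p * ln (1 / \<epsilon>) \<le> p * L" "1 \<le> p * L"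
    using p L mult_mono[of 1 p 1 L] by (auto intro: mult_left_mono)
  have N\<epsilon>: "1 \<le> N / \<epsilon>" using N1 \<epsilon> by (simp add: le_divide_eq)
  have m_ge: "4 * N / \<epsilon> \<le> m" unfolding m_def by (rule real_nat_ceiling_ge)
  \<comment> \<open>Rounding up costs at most 1, which \<open>N / \<epsilon>\<close> absorbs. In the
    next two bounds \<open>p * L\<close> and \<open>K\<close>, both at least 1, absorb the additive
    constants in the same way.\<close>
  have m_le: "m \<le> 5 * (N / \<epsilon>)" using N\<epsilon> unfolding m_def by linarith
  have d_ge: "p * ln (1 / \<epsilon>) + 3 \<le> d" unfolding d_def by (rule real_nat_ceiling_ge)
  have d_le: "d \<le> 5 * (p * L)"
    using pL p ln0 mult_nonneg_nonneg[of p "ln (1 / \<epsilon>)"] unfolding d_def by linarith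
  have e_le: "e \<le> 3 * K" using K ln0 unfolding e_def by linarith
  have e_ge: "n \<le> 4 ^ e"
  proof -
    have "real n = exp (ln (real n))" using n by simp
    also have "\<dots> \<le> exp (real e)" using real_nat_ceiling_ge[of "ln (real n)"] by (simp add: e_def)
    also have "\<dots> = exp 1 ^ e" by (simp add: exp_of_nat_mult[of e 1, simplified])
    also have "\<dots> \<le> 4 ^ e" using e_less_272 by (intro power_mono) auto
    finally have "real n \<le> real (4 ^ e)" by simp
    then show ?thesis by (simp only: of_nat_le_iff)
  qed
  have m_ge': "4 * real n powr (1 - 1 / p) \<le> \<epsilon> * real m"
    using m_ge \<epsilon> by (simp add: N_def divide_le_eq mult.commute)
  have m0: "0 < m" using m_ge N\<epsilon> by (cases m) auto
  have "real (d * m * (2 * e) * 16) = 32 * (real d * (real m * real e))" by simp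
  also have "\<dots> \<le> 32 * ((5 * (p * L)) * ((5 * (N / \<epsilon>)) * (3 * K)))"
    by (intro mult_left_mono mult_mono d_le m_le e_le) (use N\<epsilon> pL K in auto)
  also have "\<dots> = 2400 * (p * (1 / \<epsilon>) * L * N * K)" by simp
  finally have k: "real (d * m * (2 * e) * 16) \<le> 2400 * (p * (1 / \<epsilon>) * L * N * K)" .
  have "0 < e" by (simp add: e_def)
  note ex = sketch_exists[OF p \<epsilon> m_ge' m0 d_ge this e_ge]
  then show "\<exists>(k::nat) (M::real mat measure) (R::real mat \<Rightarrow> real vec \<Rightarrow> real vec).
      real k \<le> 2400 * (p * (1 / \<epsilon>) * log_ge1 (1 / \<epsilon>) * real n powr (1 - 1 / p) * log_ge1 (real n)) \<and>
      linear_sketch k n M R \<and>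
      (\<forall>x\<in>carrier_vec n. (\<forall>i<n. 0 \<le> x $ i) \<longrightarrow>
        (\<forall>A\<in>space M. \<forall>i<n. R A (A *\<^sub>v x) $ i \<le> x $ i) \<and>
        \<P>(A in M. \<forall>i<n. R A (A *\<^sub>v x) $ i \<ge> x $ i - \<epsilon> * lp_norm p x) \<ge> 9 / 10)"
    using k unfolding L_def N_def K_def by blast
qed simp

end
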